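(* Every finite positively-edge-weighted directed graph $D=(V,E,\omega)$ is ranked-majority $2$-paintable, i.e. Painter has a winning strategy in the ranked-majority $\lambda$-painting game on $D$ with $\lambda(v)=2$ for every $v\in V$.
   Context: A positively-edge-weighted directed graph is a tuple $D=(V,E,\omega)$ with $V$ a finite vertex set, $E$ a set of ordered pairs $vw$ of distinct vertices (edges directed from $v$ to $w$), and $\omega:E\to\mathbb{R}_{>0}$. Given $\lambda$ assigning a positive real $\lambda(v)$ to each vertex, the ranked-majority $\lambda$-painting game on $D$ is played in rounds by Lister and Painter; initially all vertices are uncolored. In round $i=1,2,\dots$, Lister presents a non-empty set $X_i$ of uncolored vertices together with a function $\tau_i$ assigning a non-negative real $\tau_i(v)$ to each $v\in X_i$. Painter responds with $Y_i\subseteq X_i$, whose vertices receive color $i$, such that for every $v\in Y_i$: $\sum_{vw\in E,\,w\in Y_i}\omega(vw)\le \tau_i(v)\cdot\sum_{vw\in E}\omega(vw)$. Painter wins after round $m$ if $\bigcup_{i\le m}Y_i=V$. Lister wins after round $m$ if some vertex $v\notin\bigcup_{i\le m}Y_i$ satisfies $\sum_{i:\,v\in X_i}\tau_i(v)\ge\lambda(v)$. Otherwise the game continues. $D$ is ranked-majority $\lambda$-paintable if Painter has a winning strategy; "ranked-majority $c$-paintable" means $\lambda\equiv c$. *)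

theory Defs
  imports Complex_Main "HOL-Library.FuncSet"
    "Graph_Theory.Pair_Digraph" "Graph_Theory.Weighted_Graph"
begin

locale pos_weighted_digraph = pair_digraph D for D :: "'a pair_pre_digraph" +
  fixes \<omega> :: "('a \<times> 'a) weight_fun"
  assumes weight_pos: "e \<in> parcs D \<Longrightarrow> \<omega> e > 0"

text \<open>A round is a triple \<open>(X, \<tau>, Y)\<close>: the vertices and ranks presented by Lister and the
  set coloured by Painter. A history lists the rounds played so far, oldest first.\<close>

type_synonym 'a round = "'a set \<times> ('a \<Rightarrow> real) \<times> 'a set"
type_synonym 'a history = "'a round list"

definition coloured :: "'a history \<Rightarrow> 'a set" where
  "coloured h = (\<Union>(X, \<tau>, Y) \<in> set h. Y)"

definition lister_move ::
  "'a pair_pre_digraph \<Rightarrow> 'a history \<Rightarrow> 'a set \<Rightarrow> ('a \<Rightarrow> real) \<Rightarrow> bool" where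
  "lister_move D h X \<tau> \<longleftrightarrow> X \<noteq> {} \<and> X \<subseteq> pverts D - coloured h \<and> \<tau> \<in> X \<rightarrow>\<^sub>E {0..}"

definition painter_response ::
  "'a pair_pre_digraph \<Rightarrow> ('a \<times> 'a) weight_fun \<Rightarrow> 'a set \<Rightarrow> ('a \<Rightarrow> real) \<Rightarrow> 'a set \<Rightarrow> bool" where
  "painter_response D \<omega> X \<tau> Y \<longleftrightarrow> Y \<subseteq> X \<and>
     (\<forall>v \<in> Y. (\<Sum>w | (v, w) \<in> parcs D \<and> w \<in> Y. \<omega> (v, w))
               \<le> \<tau> v * (\<Sum>w | (v, w) \<in> parcs D. \<omega> (v, w)))"

text \<open>The thresholds \<open>\<Lambda>\<close> below are meant to be positive, so that Lister has not won at the
  start.\<close>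

definition painter_won :: "'a pair_pre_digraph \<Rightarrow> 'a history \<Rightarrow> bool" where
  "painter_won D h \<longleftrightarrow> coloured h = pverts D"

definition lister_won :: "'a pair_pre_digraph \<Rightarrow> ('a \<Rightarrow> real) \<Rightarrow> 'a history \<Rightarrow> bool" where
  "lister_won D \<Lambda> h \<longleftrightarrow> (\<exists>v \<in> pverts D - coloured h.
     (\<Sum>(X, \<tau>, Y) \<leftarrow> filter (\<lambda>(X, \<tau>, Y). v \<in> X) h. \<tau> v) \<ge> \<Lambda> v)"

type_synonym 'a painter_strategy = "'a history \<Rightarrow> 'a set \<Rightarrow> ('a \<Rightarrow> real) \<Rightarrow> 'a set"

text \<open>The histories that can arise when Painter follows \<open>\<sigma>\<close> and Lister moves legally. They
  are only extended while nobody has won.\<close>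

inductive play_of ::
  "'a pair_pre_digraph \<Rightarrow> ('a \<Rightarrow> real) \<Rightarrow> 'a painter_strategy \<Rightarrow> 'a history \<Rightarrow> bool"
  for D \<Lambda> \<sigma> where
  start: "play_of D \<Lambda> \<sigma> []"
| step: "\<lbrakk>play_of D \<Lambda> \<sigma> h; \<not> painter_won D h; \<not> lister_won D \<Lambda> h; lister_move D h X \<tau>\<rbrakk>
    \<Longrightarrow> play_of D \<Lambda> \<sigma> (h @ [(X, \<tau>, \<sigma> h X \<tau>)])"

text \<open>A winning strategy answers legally, never lets Lister win, and excludes infinite plays.
  Since Lister has a legal move as long as some vertex is uncoloured, this means that every
  play ends, after finitely many rounds, with a win for Painter.\<close>

definition winning_strategy ::
  "'a pair_pre_digraph \<Rightarrow> ('a \<times> 'a) weight_fun \<Rightarrow> ('a \<Rightarrow> real) \<Rightarrow> 'a painter_strategy \<Rightarrow> bool" where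
  "winning_strategy D \<omega> \<Lambda> \<sigma> \<longleftrightarrow>
     (\<forall>h X \<tau>. play_of D \<Lambda> \<sigma> h \<and> \<not> painter_won D h \<and> \<not> lister_won D \<Lambda> h \<and> lister_move D h X \<tau>
        \<longrightarrow> painter_response D \<omega> X \<tau> (\<sigma> h X \<tau>)) \<and>
     (\<forall>h. play_of D \<Lambda> \<sigma> h \<longrightarrow> \<not> lister_won D \<Lambda> h) \<and>
     \<not> (\<exists>r :: nat \<Rightarrow> 'a round. \<forall>n. play_of D \<Lambda> \<sigma> (map r [0..<n]))"

definition ranked_majority_paintable ::
  "'a pair_pre_digraph \<Rightarrow> ('a \<times> 'a) weight_fun \<Rightarrow> ('a \<Rightarrow> real) \<Rightarrow> bool" where
  "ranked_majority_paintable D \<omega> \<Lambda> \<longleftrightarrow> (\<exists>\<sigma>. winning_strategy D \<omega> \<Lambda> \<sigma>)"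

end

theory Submission
  imports Defs
begin

text \<open>Let \<open>M\<close> be the matrix of out-weights with rows normalised to sum at most 1. If \<open>p\<close> is a
  positive vector with \<open>p M \<le> (1 + \<delta>) p\<close>, the symmetric weights
  \<open>s v w = p v * M v w + p w * M w v\<close> have total at most \<open>(2 + \<delta>) * p v\<close> at \<open>v\<close>. Painter answers
  \<open>(X, \<tau>)\<close> by a nonempty \<open>Y\<close> that minimises the total \<open>s\<close>-weight inside \<open>Y\<close> minus
  \<open>\<Sum>v\<in>Y. (1 + \<delta>) * p v * \<tau> v\<close>. By local optimality every \<open>v \<in> Y\<close> has \<open>M\<close>-weight at most
  \<open>(1 + \<delta>) * \<tau> v\<close> into \<open>Y\<close>, while every \<open>v \<in> X - Y\<close> has \<open>s\<close>-weight at least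
  \<open>(1 + \<delta>) * p v * \<tau> v\<close> to \<open>Y\<close>. The sets \<open>Y\<close> of different rounds are disjoint, so the ranks
  given to an uncoloured vertex add up to at most \<open>(2 + \<delta>) / (1 + \<delta>) < 2\<close>.

  A positive \<open>p\<close> need not exist for \<open>\<delta> = 0\<close> (unless the digraph is strongly connected), so
  legality only holds up to the factor \<open>1 + \<delta>\<close>. Since there are finitely many candidates
  for \<open>Y\<close>, Painter can choose one that is right for arbitrarily small \<open>\<delta>\<close>.\<close>

section \<open>Limits at zero and almost excessive vectors\<close>

lemma frequently_at_right_0_le_mult:
  fixes a b :: real
  assumes "\<exists>\<^sub>F \<delta> in at_right 0. a \<le> (1 + \<delta>) * b"
  shows "a \<le> b"
proof (rule ccontr)
  assume "\<not> a \<le> b"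
  moreover have "((\<lambda>\<delta>. (1 + \<delta>) * b) \<longlongrightarrow> (1 + 0) * b) (at_right 0)"
    by (intro tendsto_intros)
  ultimately have "\<forall>\<^sub>F \<delta> in at_right 0. (1 + \<delta>) * b < a"
    by (intro order_tendstoD(2)) auto
  with assms show False
    by (auto simp: frequently_def not_le)
qed

text \<open>The witness is \<open>\<Sum>k. c ^ k * 1 M\<^sup>k\<close> with \<open>c = 1 / (1 + \<delta>)\<close>, where \<open>1\<close> is the all-ones row
  vector.\<close>

lemma substochastic_almost_excessive_vector:
  fixes M :: "'a \<Rightarrow> 'a \<Rightarrow> real" and \<delta> :: real
  assumes fin: "finite V"
    and nonneg: "\<And>v w. 0 \<le> M v w"
    and row: "\<And>v. v \<in> V \<Longrightarrow> (\<Sum>w\<in>V. M v w) \<le> 1"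
    and "0 < \<delta>"
  shows "\<exists>p. (\<forall>v. 0 < p v) \<and> (\<forall>v\<in>V. (\<Sum>u\<in>V. p u * M u v) \<le> (1 + \<delta>) * p v)"
proof -
  define c where "c = 1 / (1 + \<delta>)"
  have c: "0 < c" "c < 1" using \<open>0 < \<delta>\<close> by (auto simp: c_def)
  define m where "m = rec_nat (\<lambda>_. 1) (\<lambda>_ f v. \<Sum>u\<in>V. f u * M u v)"
  have m0: "m 0 v = 1" and mS: "m (Suc k) v = (\<Sum>u\<in>V. m k u * M u v)" for k v
    by (auto simp: m_def)
  have m_nonneg: "0 \<le> m k v" for k v
    by (induction k arbitrary: v) (auto simp: m0 mS nonneg intro!: sum_nonneg)
  \<comment> \<open>Row sums at most 1 keep the total mass from growing with \<open>k\<close>. Hence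
    all entries on \<open>V\<close> share one bound, and a geometric series dominates the
    witness.\<close>
  have m_total: "(\<Sum>v\<in>V. m k v) \<le> real (card V)" for k
  proof (induction k)
    case 0
    show ?case by (simp add: m0)
  next
    case (Suc k)
    have "(\<Sum>v\<in>V. m (Suc k) v) = (\<Sum>u\<in>V. m k u * (\<Sum>v\<in>V. M u v))"
      unfolding mS by (subst sum.swap) (simp add: sum_distrib_left)
    also have "\<dots> \<le> (\<Sum>u\<in>V. m k u)"
      using row m_nonneg by (intro sum_mono) (simp add: mult_left_le)
    finally show ?case using Suc by simp
  qed
  have summ: "summable (\<lambda>k. c ^ k * m k v)" if "v \<in> V" for v
  proof (rule summable_comparison_test')
    show "summable (\<lambda>k. real (card V) * c ^ k)"
      using c by (intro summable_mult summable_geometric) auto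
    have "m k v \<le> real (card V)" for k
      using member_le_sum[of v V "m k"] fin that m_nonneg m_total[of k] by force
    then show "norm (c ^ k * m k v) \<le> real (card V) * c ^ k" for k
      using c m_nonneg by (simp add: abs_mult mult.commute mult_left_mono)
  qed
  \<comment> \<open>The default 1 makes \<open>p\<close> positive outside \<open>V\<close> as
    well.\<close>
  define p where "p v = (if v \<in> V then \<Sum>k. c ^ k * m k v else 1)" for v
  have head: "p v = 1 + (\<Sum>k. c ^ Suc k * m (Suc k) v)" if "v \<in> V" for v
    using suminf_split_head[OF summ[OF that]] that by (simp add: p_def m0)
  have tail_nonneg: "0 \<le> (\<Sum>k. c ^ Suc k * m (Suc k) v)" if "v \<in> V" for v
    using summ[OF that] c m_nonneg
    by (intro suminf_nonneg) (auto simp del: power_Suc intro: summable_Suc_iff[THEN iffD2])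
  have "0 < p v" for v
    using head tail_nonneg by (cases "v \<in> V") (force, simp add: p_def)
  moreover have "(\<Sum>u\<in>V. p u * M u v) \<le> (1 + \<delta>) * p v" if v: "v \<in> V" for v
  proof -
    \<comment> \<open>Multiplying by \<open>M\<close> and \<open>c\<close> shifts the series by one
      index, so on \<open>V\<close> it yields \<open>p\<close> minus its leading term 1.\<close>
    have "c * (\<Sum>u\<in>V. p u * M u v) = (\<Sum>u\<in>V. \<Sum>k. c * M u v * (c ^ k * m k u))"
      by (simp add: p_def suminf_mult summ sum_distrib_left mult_ac)
    also have "\<dots> = (\<Sum>k. \<Sum>u\<in>V. c * M u v * (c ^ k * m k u))"
      by (intro suminf_sum[symmetric] summable_mult summ)
    also have "\<dots> = (\<Sum>k. c ^ Suc k * m (Suc k) v)"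
      by (simp add: mS sum_distrib_left mult_ac)
    also have "\<dots> \<le> p v"
      using head[OF v] by simp
    finally show ?thesis
      using \<open>0 < \<delta>\<close> by (simp add: c_def field_simps)
  qed
  ultimately show ?thesis by blast
qed

section \<open>Locally optimal subsets\<close>

lemma locally_optimal_subset:
  fixes s :: "'a \<Rightarrow> 'a \<Rightarrow> real" and t :: "'a \<Rightarrow> real"
  assumes fin: "finite X" and "X \<noteq> {}"
    and sym: "\<And>v w. s v w = s w v"
    and irrefl: "\<And>v. s v v = 0"
    and t_nonneg: "\<And>v. v \<in> X \<Longrightarrow> 0 \<le> t v"
  obtains Y where "Y \<subseteq> X" "Y \<noteq> {}" "\<And>v. v \<in> Y \<Longrightarrow> (\<Sum>w\<in>Y. s v w) \<le> t v"
    "\<And>v. v \<in> X - Y \<Longrightarrow> t v \<le> (\<Sum>w\<in>Y. s v w)"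
proof -
  \<comment> \<open>The double sum counts every unordered pair twice; the factor 2 on
    \<open>t\<close> matches this, so inserting a vertex compares its weight into \<open>Y\<close>
    with exactly \<open>t v\<close>.\<close>
  define \<Phi> where "\<Phi> Y = (\<Sum>v\<in>Y. \<Sum>w\<in>Y. s v w) - 2 * (\<Sum>v\<in>Y. t v)" for Y
  have \<Phi>_insert: "\<Phi> (insert v Y) = \<Phi> Y + 2 * ((\<Sum>w\<in>Y. s v w) - t v)"
    if "finite Y" "v \<notin> Y" for v Y
  proof -
    have "(\<Sum>u\<in>Y. s u v) = (\<Sum>u\<in>Y. s v u)" by (simp add: sym)
    then show ?thesis
      using that by (simp add: \<Phi>_def sum.distrib irrefl algebra_simps)
  qed
  have "finite (Pow X - {{}})" "Pow X - {{}} \<noteq> {}"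
    using fin \<open>X \<noteq> {}\<close> by auto
  then obtain Y where Y: "Y \<in> Pow X - {{}}" and min: "\<And>Z. Z \<in> Pow X - {{}} \<Longrightarrow> \<Phi> Y \<le> \<Phi> Z"
    using arg_min_if_finite[of "Pow X - {{}}" \<Phi>] by (metis not_less)
  have finY: "finite Y" using Y fin by (auto intro: finite_subset)
  have "(\<Sum>w\<in>Y. s v w) \<le> t v" if v: "v \<in> Y" for v
  proof (cases "Y = {v}")
    case True
    \<comment> \<open>Deleting \<open>v\<close> would leave the excluded empty set, so minimality
      says nothing here.\<close>
    then show ?thesis using irrefl t_nonneg Y by auto
  next
    case False
    with Y v have "\<Phi> Y \<le> \<Phi> (Y - {v})" by (intro min) auto
    also have "\<Phi> Y = \<Phi> (Y - {v}) + 2 * ((\<Sum>w\<in>Y - {v}. s v w) - t v)"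
      using \<Phi>_insert[of "Y - {v}" v] finY v by (simp add: insert_absorb)
    also have "(\<Sum>w\<in>Y - {v}. s v w) = (\<Sum>w\<in>Y. s v w)"
      using finY v by (simp add: sum_diff1 irrefl)
    finally show ?thesis by simp
  qed
  moreover have "t v \<le> (\<Sum>w\<in>Y. s v w)" if v: "v \<in> X - Y" for v
    using min[of "insert v Y"] \<Phi>_insert[of Y v] finY Y v by auto
  ultimately show thesis using Y that by blast
qed

section \<open>Winning strategies from invariants\<close>

lemma coloured_snoc: "coloured (h @ [(X, \<tau>, Y)]) = coloured h \<union> Y"
  by (auto simp: coloured_def)

text \<open>Insisting on nonempty answers rules out infinite plays.\<close>

lemma ranked_majority_paintable_by_invariant:
  assumes fin: "finite (pverts D)"
    and init: "Inv []"
    and safe: "\<And>h. coloured h \<subseteq> pverts D \<Longrightarrow> Inv h \<Longrightarrow> \<not> lister_won D \<Lambda> h"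
    and step: "\<And>h X \<tau>. coloured h \<subseteq> pverts D \<Longrightarrow> Inv h \<Longrightarrow> lister_move D h X \<tau> \<Longrightarrow>
      \<exists>Y. Y \<noteq> {} \<and> painter_response D \<omega> X \<tau> Y \<and> Inv (h @ [(X, \<tau>, Y)])"
  shows "ranked_majority_paintable D \<omega> \<Lambda>"
proof -
  define good where
    "good h X \<tau> Y \<longleftrightarrow> Y \<noteq> {} \<and> painter_response D \<omega> X \<tau> Y \<and> Inv (h @ [(X, \<tau>, Y)])" for h X \<tau> Y
  define \<sigma> where "\<sigma> h X \<tau> = (SOME Y. good h X \<tau> Y)" for h X \<tau>
  have \<sigma>: "good h X \<tau> (\<sigma> h X \<tau>)"
    if "coloured h \<subseteq> pverts D" "Inv h" "lister_move D h X \<tau>" for h X \<tau>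
    unfolding \<sigma>_def by (rule someI_ex) (use step[OF that] in \<open>simp add: good_def\<close>)
  \<comment> \<open>Answers are nonempty and disjoint from earlier ones, so every round colours at
    least one new vertex.\<close>
  have inv: "Inv h \<and> coloured h \<subseteq> pverts D \<and> length h \<le> card (coloured h)"
    if "play_of D \<Lambda> \<sigma> h" for h
    using that
  proof induction
    case start
    show ?case by (simp add: init coloured_def)
  next
    case (step h X \<tau>)
    let ?Y = "\<sigma> h X \<tau>"
    have good: "good h X \<tau> ?Y" using step \<sigma> by blast
    then have "?Y \<noteq> {}" "?Y \<subseteq> X" by (auto simp: good_def painter_response_def)
    moreover have "X \<subseteq> pverts D - coloured h" using step by (simp add: lister_move_def)
    ultimately have Y: "?Y \<noteq> {}" "?Y \<subseteq> pverts D" "coloured h \<inter> ?Y = {}" by auto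
    then have "card (coloured h \<union> ?Y) = card (coloured h) + card ?Y" "card ?Y > 0"
      using fin step by (auto intro!: card_Un_disjoint simp: card_gt_0_iff intro: finite_subset)
    then show ?case using good step Y by (auto simp: coloured_snoc good_def)
  qed
  have "\<not> (\<forall>n. play_of D \<Lambda> \<sigma> (map r [0..<n]))" for r
  proof
    let ?h = "map r [0..<Suc (card (pverts D))]"
    assume "\<forall>n. play_of D \<Lambda> \<sigma> (map r [0..<n])"
    then have "play_of D \<Lambda> \<sigma> ?h" by blast
    then have "coloured ?h \<subseteq> pverts D" "length ?h \<le> card (coloured ?h)"
      using inv by blast+
    with card_mono[OF fin, of "coloured ?h"] show False by (simp del: upt_Suc)
  qed
  then have "winning_strategy D \<omega> \<Lambda> \<sigma>"
    unfolding winning_strategy_def using inv safe \<sigma> by (auto simp: good_def)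
  then show ?thesis unfolding ranked_majority_paintable_def by blast
qed

definition rank_sum :: "'a \<Rightarrow> 'a history \<Rightarrow> real" where
  "rank_sum v h = (\<Sum>(X, \<tau>, Y) \<leftarrow> filter (\<lambda>(X, \<tau>, Y). v \<in> X) h. \<tau> v)"

lemma rank_sum_Nil: "rank_sum v [] = 0"
  by (simp add: rank_sum_def)

lemma rank_sum_snoc: "rank_sum v (h @ [(X, \<tau>, Y)]) = rank_sum v h + (if v \<in> X then \<tau> v else 0)"
  by (simp add: rank_sum_def)

lemma lister_won_iff_rank_sum:
  "lister_won D \<Lambda> h \<longleftrightarrow> (\<exists>v \<in> pverts D - coloured h. \<Lambda> v \<le> rank_sum v h)"
  by (simp add: lister_won_def rank_sum_def)

section \<open>Normalised out-weights and Painter's strategy\<close>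

context pos_weighted_digraph
begin

definition out_weight :: "'a \<Rightarrow> real" where
  "out_weight v = (\<Sum>w | (v, w) \<in> parcs D. \<omega> (v, w))"

definition trans_weight :: "'a \<Rightarrow> 'a \<Rightarrow> real" where
  "trans_weight v w = (if (v, w) \<in> parcs D then \<omega> (v, w) / out_weight v else 0)"

lemma finite_out: "finite {w. (v, w) \<in> parcs D}"
  by (rule finite_subset[of _ "snd ` parcs D"]) (force, simp)

lemma out_weight_pos:
  assumes "(v, w) \<in> parcs D"
  shows "0 < out_weight v"
  unfolding out_weight_def using assms weight_pos finite_out
  by (intro sum_pos) auto

lemma trans_weight_nonneg: "0 \<le> trans_weight v w"
  using weight_pos[of "(v, w)"] out_weight_pos[of v w] by (auto simp: trans_weight_def)

lemma trans_weight_irrefl: "trans_weight v v = 0"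
  using pair_no_loops[of "(v, v)"] by (auto simp: trans_weight_def)

lemma sum_trans_weight:
  assumes "finite Y"
  shows "(\<Sum>w\<in>Y. trans_weight v w) = (\<Sum>w | (v, w) \<in> parcs D \<and> w \<in> Y. \<omega> (v, w)) / out_weight v"
proof -
  have "(\<Sum>w\<in>Y. trans_weight v w) = (\<Sum>w\<in>{w\<in>Y. (v, w) \<in> parcs D}. \<omega> (v, w) / out_weight v)"
    unfolding trans_weight_def using assms by (simp add: sum.inter_filter)
  also have "{w\<in>Y. (v, w) \<in> parcs D} = {w. (v, w) \<in> parcs D \<and> w \<in> Y}" by auto
  finally show ?thesis by (simp add: sum_divide_distrib)
qed

text \<open>The sum is \<open>out_weight v / out_weight v\<close>: 1 if an arc leaves
  \<open>v\<close>, and otherwise 0 by the convention for division by zero.\<close>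

lemma sum_trans_weight_le_1: "(\<Sum>w\<in>pverts D. trans_weight v w) \<le> 1"
proof -
  have "{w. (v, w) \<in> parcs D \<and> w \<in> pverts D} = {w. (v, w) \<in> parcs D}"
    using in_arcsD2 by auto
  then show ?thesis
    by (simp add: sum_trans_weight flip: out_weight_def)
qed

lemma painter_responseI:
  assumes "Y \<subseteq> X" "finite Y" and le: "\<And>v. v \<in> Y \<Longrightarrow> (\<Sum>w\<in>Y. trans_weight v w) \<le> \<tau> v"
  shows "painter_response D \<omega> X \<tau> Y"
  unfolding painter_response_def out_weight_def[symmetric]
proof (intro conjI ballI)
  fix v assume v: "v \<in> Y"
  show "(\<Sum>w | (v, w) \<in> parcs D \<and> w \<in> Y. \<omega> (v, w)) \<le> \<tau> v * out_weight v"
  proof (cases "\<exists>w. (v, w) \<in> parcs D")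
    case True
    then show ?thesis
      using le[OF v] out_weight_pos by (auto simp: sum_trans_weight[OF \<open>finite Y\<close>] field_simps)
  qed (simp add: out_weight_def)
qed fact

theorem ranked_majority_2_paintable: "ranked_majority_paintable D \<omega> (\<lambda>_. 2)"
proof -
  let ?V = "pverts D"
  have "\<forall>\<delta>. \<exists>p. 0 < \<delta> \<longrightarrow> (\<forall>v. 0 < p v) \<and>
      (\<forall>v\<in>?V. (\<Sum>u\<in>?V. p u * trans_weight u v) \<le> (1 + \<delta>) * p v)"
    using substochastic_almost_excessive_vector[of ?V trans_weight]
      trans_weight_nonneg sum_trans_weight_le_1 by (meson finite_verts)
  then obtain p :: "real \<Rightarrow> 'a \<Rightarrow> real" where
    p_pos: "\<And>\<delta> v. 0 < \<delta> \<Longrightarrow> 0 < p \<delta> v" and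
    p_excessive: "\<And>\<delta> v. 0 < \<delta> \<Longrightarrow> v \<in> ?V \<Longrightarrow>
      (\<Sum>u\<in>?V. p \<delta> u * trans_weight u v) \<le> (1 + \<delta>) * p \<delta> v"
    by metis
  define s where "s \<delta> v w = p \<delta> v * trans_weight v w + p \<delta> w * trans_weight w v" for \<delta> v w
  have s_sym: "s \<delta> v w = s \<delta> w v" and s_irrefl: "s \<delta> v v = 0" for \<delta> v w
    by (simp_all add: s_def trans_weight_irrefl)
  have s_nonneg: "0 \<le> s \<delta> v w" if "0 < \<delta>" for \<delta> v w
    using p_pos[OF that] trans_weight_nonneg by (simp add: s_def less_imp_le)
  \<comment> \<open>The row part of \<open>s\<close> contributes at most \<open>p \<delta> v\<close>
    by substochasticity, the column part at most \<open>(1 + \<delta>) * p \<delta> v\<close> by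
    excessiveness.\<close>
  have s_total: "(\<Sum>w\<in>?V. s \<delta> v w) \<le> (2 + \<delta>) * p \<delta> v" if "0 < \<delta>" "v \<in> ?V" for \<delta> v
  proof -
    have "p \<delta> v * (\<Sum>w\<in>?V. trans_weight v w) \<le> p \<delta> v"
      using p_pos[OF that(1)] sum_trans_weight_le_1 by (simp add: mult_left_le less_imp_le)
    then show ?thesis
      using p_excessive[OF that] by (simp add: s_def sum.distrib sum_distrib_left algebra_simps)
  qed
  define bounded where "bounded \<delta> h \<longleftrightarrow>
    (\<forall>v\<in>?V - coloured h. (1 + \<delta>) * p \<delta> v * rank_sum v h \<le> (\<Sum>w\<in>coloured h. s \<delta> v w))" for \<delta> h
  have pos: "\<forall>\<^sub>F \<delta> :: real in at_right 0. 0 < \<delta>"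
    by (simp add: eventually_at_right_less)
  \<comment> \<open>No single \<delta> is fixed for the whole game: each round may discard some
    values, as long as arbitrarily small ones survive.\<close>
  show ?thesis
  proof (rule ranked_majority_paintable_by_invariant
      [where Inv = "\<lambda>h. \<exists>\<^sub>F \<delta> in at_right 0. bounded \<delta> h"])
    show "finite ?V" by simp
    show "\<exists>\<^sub>F \<delta> in at_right 0. bounded \<delta> []"
      unfolding bounded_def coloured_def rank_sum_Nil
      by (simp add: frequently_const_iff trivial_limit_at_right_real)
  next
    fix h assume col: "coloured h \<subseteq> ?V" and "\<exists>\<^sub>F \<delta> in at_right 0. bounded \<delta> h"
    then obtain \<delta> where \<delta>: "bounded \<delta> h" "0 < \<delta>"
      using frequently_ex[OF frequently_eventually_conj[OF _ pos]] by metis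
    have "rank_sum v h < 2" if v: "v \<in> ?V - coloured h" for v
    proof -
      have "(1 + \<delta>) * p \<delta> v * rank_sum v h \<le> (\<Sum>w\<in>coloured h. s \<delta> v w)"
        using \<delta> v by (simp add: bounded_def)
      also have "\<dots> \<le> (\<Sum>w\<in>?V. s \<delta> v w)"
        using col s_nonneg \<delta> by (intro sum_mono2) auto
      also have "\<dots> \<le> (2 + \<delta>) * p \<delta> v"
        using s_total \<delta> v by simp
      \<comment> \<open>Strict because \<open>2 + \<delta> < 2 + 2 * \<delta>\<close>; this keeps
        the rank sum below the threshold 2.\<close>
      also have "\<dots> < (1 + \<delta>) * p \<delta> v * 2"
        using p_pos[OF \<delta>(2), of v] \<delta> by (simp add: algebra_simps)
      finally show ?thesis
        using p_pos[OF \<delta>(2), of v] \<delta> by (simp add: mult_less_cancel_left)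
    qed
    then show "\<not> lister_won D (\<lambda>_. 2) h"
      by (force simp: lister_won_iff_rank_sum)
  next
    fix h X \<tau>
    assume col: "coloured h \<subseteq> ?V" and inv: "\<exists>\<^sub>F \<delta> in at_right 0. bounded \<delta> h"
      and move: "lister_move D h X \<tau>"
    have X: "X \<noteq> {}" "X \<subseteq> ?V - coloured h" and \<tau>: "\<And>v. v \<in> X \<Longrightarrow> 0 \<le> \<tau> v"
      using move by (auto simp: lister_move_def)
    have fin: "finite X" "finite (coloured h)"
      using X col by (auto intro: finite_subset[of _ ?V])
    define ok where "ok \<delta> Y \<longleftrightarrow> bounded \<delta> (h @ [(X, \<tau>, Y)]) \<and>
      (\<forall>v\<in>Y. (\<Sum>w\<in>Y. trans_weight v w) \<le> (1 + \<delta>) * \<tau> v)" for \<delta> Y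
    have "\<exists>Y\<in>Pow X - {{}}. ok \<delta> Y" if bdd: "bounded \<delta> h" and \<delta>: "0 < \<delta>" for \<delta>
    proof -
      define t where "t v = (1 + \<delta>) * p \<delta> v * \<tau> v" for v
      have t_nonneg: "0 \<le> t v" if "v \<in> X" for v
        using \<tau>[OF that] p_pos[OF \<delta>, of v] \<delta> by (simp add: t_def)
      obtain Y where Y: "Y \<subseteq> X" "Y \<noteq> {}"
        and inside: "\<And>v. v \<in> Y \<Longrightarrow> (\<Sum>w\<in>Y. s \<delta> v w) \<le> t v"
        and outside: "\<And>v. v \<in> X - Y \<Longrightarrow> t v \<le> (\<Sum>w\<in>Y. s \<delta> v w)"
        using locally_optimal_subset[of X "s \<delta>" t, OF fin(1) X(1) s_sym s_irrefl t_nonneg]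
        by (metis (no_types))
      have "(\<Sum>w\<in>Y. trans_weight v w) \<le> (1 + \<delta>) * \<tau> v" if "v \<in> Y" for v
      proof -
        have "p \<delta> v * (\<Sum>w\<in>Y. trans_weight v w) \<le> (\<Sum>w\<in>Y. s \<delta> v w)"
          unfolding sum_distrib_left s_def
          using p_pos[OF \<delta>] trans_weight_nonneg by (intro sum_mono) (simp add: less_imp_le)
        also have "\<dots> \<le> p \<delta> v * ((1 + \<delta>) * \<tau> v)"
          using inside[OF that] by (simp add: t_def mult_ac)
        finally show ?thesis
          using p_pos[OF \<delta>, of v] by simp
      qed
      moreover have "bounded \<delta> (h @ [(X, \<tau>, Y)])"
        unfolding bounded_def coloured_snoc
      proof
        fix v assume v: "v \<in> ?V - (coloured h \<union> Y)"
        have "(1 + \<delta>) * p \<delta> v * rank_sum v h \<le> (\<Sum>w\<in>coloured h. s \<delta> v w)"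
          using bdd v by (simp add: bounded_def)
        \<comment> \<open>For \<open>v\<close> in \<open>X\<close> this is local optimality;
          otherwise the left side is 0.\<close>
        moreover have "(1 + \<delta>) * p \<delta> v * (if v \<in> X then \<tau> v else 0) \<le> (\<Sum>w\<in>Y. s \<delta> v w)"
          using outside[of v] v s_nonneg[OF \<delta>] by (auto simp: t_def intro: sum_nonneg)
        moreover have "(\<Sum>w\<in>coloured h \<union> Y. s \<delta> v w) = (\<Sum>w\<in>coloured h. s \<delta> v w) + (\<Sum>w\<in>Y. s \<delta> v w)"
          using fin X Y by (intro sum.union_disjoint) (auto intro: finite_subset)
        ultimately show "(1 + \<delta>) * p \<delta> v * rank_sum v (h @ [(X, \<tau>, Y)]) \<le> (\<Sum>w\<in>coloured h \<union> Y. s \<delta> v w)"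
          by (simp only: rank_sum_snoc distrib_left)
      qed
      ultimately show ?thesis
        using Y by (auto simp: ok_def)
    qed
    then have "\<exists>\<^sub>F \<delta> in at_right 0. \<exists>Y\<in>Pow X - {{}}. ok \<delta> Y"
      by (intro frequently_rev_mp[OF inv] eventually_mono[OF pos]) blast
    \<comment> \<open>Pigeonhole: of the finitely many candidates, one works for arbitrarily small
      \<delta>. For the same \<delta> it is almost legal and preserves the bound.\<close>
    then have "\<exists>Y\<in>Pow X - {{}}. \<exists>\<^sub>F \<delta> in at_right 0. ok \<delta> Y"
      using fin by (intro frequently_bex_finite) simp_all
    then obtain Y where Y: "Y \<subseteq> X" "Y \<noteq> {}" and ok: "\<exists>\<^sub>F \<delta> in at_right 0. ok \<delta> Y"
      by auto
    \<comment> \<open>With \<open>Y\<close> now independent of \<delta>, letting \<delta> tend to 0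
      removes the factor \<open>1 + \<delta>\<close>.\<close>
    have "(\<Sum>w\<in>Y. trans_weight v w) \<le> \<tau> v" if "v \<in> Y" for v
      by (rule frequently_at_right_0_le_mult, rule frequently_elim1[OF ok])
        (use that in \<open>simp add: ok_def\<close>)
    then have "painter_response D \<omega> X \<tau> Y"
      using Y fin by (intro painter_responseI) (auto intro: finite_subset)
    moreover have "\<exists>\<^sub>F \<delta> in at_right 0. bounded \<delta> (h @ [(X, \<tau>, Y)])"
      by (rule frequently_elim1[OF ok]) (simp add: ok_def)
    ultimately show "\<exists>Y. Y \<noteq> {} \<and> painter_response D \<omega> X \<tau> Y \<and>
        (\<exists>\<^sub>F \<delta> in at_right 0. bounded \<delta> (h @ [(X, \<tau>, Y)]))"
      using Y(2) by (intro exI[of _ Y] conjI)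
  qed
qed

end

theorem theorem2p8:
  fixes D :: "'a pair_pre_digraph" and \<omega> :: "('a \<times> 'a) weight_fun"
  assumes "pos_weighted_digraph D \<omega>"
  shows "ranked_majority_paintable D \<omega> (\<lambda>_. 2)"
  using assms by (rule pos_weighted_digraph.ranked_majority_2_paintable)

end
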